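(* Let $T=(V,E)$ be a finite tree that is not a path or a star, and let its metric $w(t)$ evolve under the Ricci flow $\frac{d}{dt}w_h=-\kappa_h w_h$, $h\in E$, from an initial metric in $\mathbb{R}_{>0}^E$. Let $e$ be a leaf edge incident to a vertex $u$ with $d_u\ge 3$, and let $d'_u$ be the number of leaf edges incident to $u$. Then: (i) $d'_u=d_u-1$ if and only if $\lim_{t\to\infty}\kappa_e(t)=\frac{1}{d_u-1}$; (ii) $\lim_{t\to\infty}\kappa_e(t)=0$ if and only if $d'_u=d_u-2$.
   Context: Trees are finite and connected; $d_u$ is the degree of $u$. Leaf edge: an edge with an endpoint of degree $1$. For a metric $w\in\mathbb{R}_{>0}^{E}$, let $d(x,y)$ be the weighted path distance and $D_x=\sum_{z\sim x}1/w_{xz}$. The curvature is the Lin-Lu-Yau version of Ollivier Ricci curvature with parameter function $\gamma(x)=1/x$: let $\mu_x^\alpha$ be the probability measure with $\mu_x^\alpha(x)=\alpha$, $\mu_x^\alpha(y)=(1-\alpha)\frac{1/w_{xy}}{D_x}$ for $y\sim x$, and $0$ otherwise; with $W$ the $L^1$ transportation distance for $d$, set $\kappa_\alpha(x,y)=1-W(\mu_x^\alpha,\mu_y^\alpha)/d(x,y)$ and $\kappa_{xy}=\lim_{\alpha\to1}\kappa_\alpha(x,y)/(1-\alpha)$. On a tree, for an edge $uv$, $\kappa_{uv}=\frac{2-d_u}{w_{uv}D_u}+\frac{2-d_v}{w_{uv}D_v}$. $\kappa_e(t)$ is the curvature with respect to $w(t)$. The flow has a unique positive solution for all $t\ge0$.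 *)

theory Defs
  imports "HOL-Analysis.Analysis"
begin

section \<open>Finite simple graphs and trees\<close>

text \<open>
  A graph is given by a vertex set \<open>V\<close> and a set \<open>E\<close> of two-element subsets of \<open>V\<close>.
\<close>

definition fin_simple_graph :: "'a set \<Rightarrow> 'a set set \<Rightarrow> bool" where
  "fin_simple_graph V E \<longleftrightarrow> finite V \<and> (\<forall>h\<in>E. h \<subseteq> V \<and> card h = 2)"

definition neighbours :: "'a set set \<Rightarrow> 'a \<Rightarrow> 'a set" where
  "neighbours E x = {y. {x, y} \<in> E}"

definition deg :: "'a set set \<Rightarrow> 'a \<Rightarrow> nat" where
  "deg E x = card (neighbours E x)"

definition path_edges :: "'a list \<Rightarrow> 'a set list" where
  "path_edges p = map (\<lambda>(x, y). {x, y}) (zip p (tl p))"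

definition simple_path :: "'a set \<Rightarrow> 'a set set \<Rightarrow> 'a list \<Rightarrow> bool" where
  "simple_path V E p \<longleftrightarrow>
     p \<noteq> [] \<and> distinct p \<and> set p \<subseteq> V \<and> set (path_edges p) \<subseteq> E"

definition paths_between :: "'a set \<Rightarrow> 'a set set \<Rightarrow> 'a \<Rightarrow> 'a \<Rightarrow> 'a list set" where
  "paths_between V E x y = {p. simple_path V E p \<and> hd p = x \<and> last p = y}"

definition connected_graph :: "'a set \<Rightarrow> 'a set set \<Rightarrow> bool" where
  "connected_graph V E \<longleftrightarrow> V \<noteq> {} \<and> (\<forall>x\<in>V. \<forall>y\<in>V. paths_between V E x y \<noteq> {})"

definition acyclic_graph :: "'a set \<Rightarrow> 'a set set \<Rightarrow> bool" where
  "acyclic_graph V E \<longleftrightarrow>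
     \<not> (\<exists>p. simple_path V E p \<and> 3 \<le> length p \<and> {last p, hd p} \<in> E)"

definition fin_tree :: "'a set \<Rightarrow> 'a set set \<Rightarrow> bool" where
  "fin_tree V E \<longleftrightarrow> fin_simple_graph V E \<and> connected_graph V E \<and> acyclic_graph V E"

definition is_path_graph :: "'a set \<Rightarrow> 'a set set \<Rightarrow> bool" where
  "is_path_graph V E \<longleftrightarrow> (\<exists>p. p \<noteq> [] \<and> distinct p \<and> V = set p \<and> E = set (path_edges p))"

definition is_star_graph :: "'a set \<Rightarrow> 'a set set \<Rightarrow> bool" where
  "is_star_graph V E \<longleftrightarrow> (\<exists>c\<in>V. E = {{c, x} |x. x \<in> V - {c}})"

definition leaf_edge :: "'a set set \<Rightarrow> 'a set \<Rightarrow> bool" where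
  "leaf_edge E h \<longleftrightarrow> h \<in> E \<and> (\<exists>x\<in>h. deg E x = 1)"

definition leaf_deg :: "'a set set \<Rightarrow> 'a \<Rightarrow> nat" where
  "leaf_deg E u = card {h. leaf_edge E h \<and> u \<in> h}"


section \<open>Lin-Lu-Yau curvature of a weighted graph\<close>

text \<open>
  Edge lengths are functions \<open>w\<close> on sets of vertices; only the values of \<open>w\<close> on \<open>E\<close> are
  used below.
\<close>

definition edge_metric :: "'a set set \<Rightarrow> ('a set \<Rightarrow> real) \<Rightarrow> bool" where
  "edge_metric E w \<longleftrightarrow> (\<forall>h\<in>E. 0 < w h)"

definition path_dist :: "'a set \<Rightarrow> 'a set set \<Rightarrow> ('a set \<Rightarrow> real) \<Rightarrow> 'a \<Rightarrow> 'a \<Rightarrow> real" where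
  "path_dist V E w x y = (INF p\<in>paths_between V E x y. sum_list (map w (path_edges p)))"

definition inv_weight_sum :: "'a set set \<Rightarrow> ('a set \<Rightarrow> real) \<Rightarrow> 'a \<Rightarrow> real" where
  "inv_weight_sum E w x = (\<Sum>z\<in>neighbours E x. 1 / w {x, z})"

text \<open>
  A probability measure on the finite set \<open>V\<close> is given by its mass function.
\<close>

definition lazy_measure :: "'a set set \<Rightarrow> ('a set \<Rightarrow> real) \<Rightarrow> real \<Rightarrow> 'a \<Rightarrow> 'a \<Rightarrow> real" where
  "lazy_measure E w \<alpha> x y =
     (if y = x then \<alpha>
      else if y \<in> neighbours E x then (1 - \<alpha>) * ((1 / w {x, y}) / inv_weight_sum E w x)
      else 0)"

definition transport_plans :: "'a set \<Rightarrow> ('a \<Rightarrow> real) \<Rightarrow> ('a \<Rightarrow> real) \<Rightarrow> ('a \<Rightarrow> 'a \<Rightarrow> real) set" where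
  "transport_plans V \<mu> \<nu> =
     {\<pi>. (\<forall>a\<in>V. \<forall>b\<in>V. 0 \<le> \<pi> a b) \<and>
         (\<forall>a\<in>V. (\<Sum>b\<in>V. \<pi> a b) = \<mu> a) \<and>
         (\<forall>b\<in>V. (\<Sum>a\<in>V. \<pi> a b) = \<nu> b)}"

definition transport_dist ::
    "'a set \<Rightarrow> ('a \<Rightarrow> 'a \<Rightarrow> real) \<Rightarrow> ('a \<Rightarrow> real) \<Rightarrow> ('a \<Rightarrow> real) \<Rightarrow> real" where
  "transport_dist V d \<mu> \<nu> =
     (INF \<pi>\<in>transport_plans V \<mu> \<nu>. \<Sum>a\<in>V. \<Sum>b\<in>V. \<pi> a b * d a b)"

definition lazy_curvature ::
    "'a set \<Rightarrow> 'a set set \<Rightarrow> ('a set \<Rightarrow> real) \<Rightarrow> real \<Rightarrow> 'a \<Rightarrow> 'a \<Rightarrow> real" where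
  "lazy_curvature V E w \<alpha> x y =
     1 - transport_dist V (path_dist V E w) (lazy_measure E w \<alpha> x) (lazy_measure E w \<alpha> y)
           / path_dist V E w x y"

text \<open>
  The limit is one-sided, since \<^term>\<open>lazy_measure E w \<alpha> x\<close> is a probability measure
  only for \<open>0 \<le> \<alpha> \<le> 1\<close>.
\<close>

definition lly_curvature ::
    "'a set \<Rightarrow> 'a set set \<Rightarrow> ('a set \<Rightarrow> real) \<Rightarrow> 'a \<Rightarrow> 'a \<Rightarrow> real" where
  "lly_curvature V E w x y = Lim (at_left 1) (\<lambda>\<alpha>. lazy_curvature V E w \<alpha> x y / (1 - \<alpha>))"


section \<open>Ricci flow\<close>

text \<open>
  \<open>w t h\<close> is the length of the edge \<open>h\<close> at time \<open>t\<close>; only times \<open>t \<ge> 0\<close> matter, and the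
  derivative at \<open>t = 0\<close> is the right derivative. An edge is written as \<open>{x, y}\<close>;
  the curvature does not depend on the order of its endpoints.
\<close>

definition ricci_flow ::
    "'a set \<Rightarrow> 'a set set \<Rightarrow> (real \<Rightarrow> 'a set \<Rightarrow> real) \<Rightarrow> bool" where
  "ricci_flow V E w \<longleftrightarrow>
     (\<forall>t\<ge>0. edge_metric E (w t)) \<and>
     (\<forall>t\<ge>0. \<forall>x y. {x, y} \<in> E \<longrightarrow>
        ((\<lambda>s. w s {x, y}) has_real_derivative
           - lly_curvature V E (w t) x y * w t {x, y}) (at t within {0..}))"

end

theory Submission
  imports Defs
begin

text \<open>
  On a tree the Lin-Lu-Yau curvature of an edge is explicit: a signed distance to one endpoint is
  an optimal Kantorovich potential for the two lazy measures. With \<open>d = d\<^sub>u\<close> and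
  \<open>F = (d - 2) / D\<^sub>u\<close>, a leaf edge at \<open>u\<close> satisfies \<open>w' = F - w\<close> and any other edge at \<open>u\<close> satisfies
  \<open>w' \<ge> F\<close>, while \<open>\<kappa>\<^sub>e = 1 - G\<close> with \<open>G = F / w\<^sub>e = (d - 2) / X\<close> and \<open>X\<close> the sum of the ratios
  \<open>w\<^sub>e / w\<^sub>h\<close> over the edges \<open>h\<close> at \<open>u\<close>. The rescaled lengths \<open>y\<^sub>h = e\<^sup>t w\<^sub>h\<close> satisfy \<open>y\<^sub>h' \<ge> G y\<^sub>e\<close>,
  with equality for leaf edges. Hence \<open>X\<close> is bounded, \<open>G\<close> is bounded below by a positive constant,
  \<open>y\<^sub>e\<close> tends to infinity, and the ratio of two leaf edges at \<open>u\<close> tends to \<open>1\<close>. For an inner edge \<open>h\<close>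
  the ratio \<open>s = w\<^sub>h / w\<^sub>e\<close> satisfies \<open>s' \<ge> G + (1 - G) s\<close>, so it tends to infinity as soon as
  \<open>limsup G \<le> 1\<close>; then \<open>\<kappa>\<^sub>e\<close> tends to \<open>1 - (d - 2) / d'\<^sub>u\<close>. The condition \<open>limsup G \<le> 1\<close> holds if
  \<open>d'\<^sub>u \<ge> d - 2\<close>, and also if \<open>\<kappa>\<^sub>e\<close> has a nonnegative limit.
\<close>

section \<open>Curvature of the edges of a tree\<close>


lemma path_edges_simps [simp]:
  "path_edges [] = []" "path_edges [x] = []"
  "path_edges (x # y # p) = {x, y} # path_edges (y # p)"
  unfolding path_edges_def by auto

lemma path_edges_append:
  "path_edges (p @ x # q) = path_edges (p @ [x]) @ path_edges (x # q)"
  by (induction p rule: induct_list012) auto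

lemma simple_path_Cons:
  "simple_path V E (x # y # p) \<longleftrightarrow>
     x \<in> V \<and> x \<notin> set (y # p) \<and> {x, y} \<in> E \<and> simple_path V E (y # p)"
  unfolding simple_path_def by auto

lemma simple_path_appendD:
  assumes "simple_path V E (p @ x # q)"
  shows "simple_path V E (p @ [x])" "simple_path V E (x # q)"
  using assms unfolding simple_path_def by (auto simp: path_edges_append[of p x q])

text \<open>With three or more vertices, the path and the edge joining its ends would form a
  cycle.\<close>

lemma simple_path_edge:
  assumes "acyclic_graph V E" "simple_path V E p" "{last p, hd p} \<in> E" "hd p \<noteq> last p"
  shows "p = [hd p, last p]"
proof -
  have "length p < 3" "p \<noteq> []"
    using assms unfolding acyclic_graph_def simple_path_def by force+
  then show ?thesis using assms(4)
    by (cases p rule: remdups_adj.cases) (auto simp: Suc_le_eq)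
qed

text \<open>Induction along the given path, with next vertex \<open>z\<close>. If \<open>z\<close>
  lies on \<open>p\<close>, the part of \<open>p\<close> up to \<open>z\<close> is closed up by the
  edge \<open>{x, z}\<close>, so it is \<open>[x, z]\<close>, and the rest is settled by induction.
  Otherwise \<open>z # p\<close> is a path too, and induction gives \<open>p = q\<close>, although
  only \<open>p\<close> contains \<open>x\<close>.\<close>

lemma simple_path_unique:
  assumes "acyclic_graph V E" "simple_path V E (x # q)"
    and "simple_path V E p" "hd p = x" "last p = last (x # q)"
  shows "p = x # q"
  using assms(2-)
proof (induction q arbitrary: x p)
  case Nil
  then have "p \<noteq> []" "distinct p" "hd p = last p" by (auto simp: simple_path_def)
  then show ?case using Nil.prems(3) by (cases p) (auto split: if_splits)
next
  case (Cons z q)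
  have q: "simple_path V E (z # q)" "x \<in> V" "x \<notin> set (z # q)" "{x, z} \<in> E"
    using Cons.prems(1) by (auto simp: simple_path_Cons)
  have p: "p \<noteq> []" "x \<in> set p"
    using Cons.prems(2,3) by (auto simp: simple_path_def)
  show ?case
  proof (cases "z \<in> set p")
    case True
    then obtain p1 p2 where p12: "p = p1 @ z # p2" by (meson split_list)
    have p1: "p1 \<noteq> []" "hd p1 = x" using p12 Cons.prems(3) q(3) by (cases p1; auto)+
    have "p1 @ [z] = [hd (p1 @ [z]), last (p1 @ [z])]"
      using simple_path_appendD(1)[of V E p1 z p2] Cons.prems(2) p12 q(3,4) p1
      by (intro simple_path_edge[OF assms(1)]) (auto simp: insert_commute)
    then have "p1 = [x]" using p1 by simp
    moreover have "z # p2 = z # q"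
      using Cons.prems(2,4) p12 simple_path_appendD(2)[of V E p1 z p2]
      by (intro Cons.IH[OF q(1)]) auto
    ultimately show ?thesis using p12 by simp
  next
    case False
    have "simple_path V E (z # p)"
      using Cons.prems(2,3) p False q(1,4)
      by (cases p) (auto simp: simple_path_Cons insert_commute, auto simp: simple_path_def)
    then have "z # p = z # q"
      using Cons.prems(4) p(1) by (intro Cons.IH[OF q(1)]) auto
    then show ?thesis using q(3) p(2) by auto
  qed
qed

text \<open>By uniqueness of paths the infimum defining the distance runs over a single
  path.\<close>

lemma path_dist_eq:
  assumes "acyclic_graph V E" "simple_path V E p"
  shows "path_dist V E w (hd p) (last p) = sum_list (map w (path_edges p))"
proof -
  have "p \<noteq> []" using assms(2) by (simp add: simple_path_def)
  then have "paths_between V E (hd p) (last p) = {p}"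
    using simple_path_unique[OF assms(1), of "hd p" "tl p"] assms(2)
    unfolding paths_between_def by auto
  then show ?thesis by (simp add: path_dist_def)
qed

section \<open>Transport plans and Kantorovich duality\<close>

lemma transport_plan_eq_0:
  assumes "finite V" "\<pi> \<in> transport_plans V \<mu> \<nu>" "a \<in> V" "b \<in> V" "\<mu> a = 0 \<or> \<nu> b = 0"
  shows "\<pi> a b = 0"
  using assms(5)
proof
  assume "\<mu> a = 0"
  then have "(\<Sum>b\<in>V. \<pi> a b) = 0" using assms unfolding transport_plans_def by auto
  then show ?thesis
    using sum_nonneg_eq_0_iff[OF assms(1), of "\<pi> a"] assms unfolding transport_plans_def by auto
next
  assume "\<nu> b = 0"
  then have "(\<Sum>a\<in>V. \<pi> a b) = 0" using assms unfolding transport_plans_def by auto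
  then show ?thesis
    using sum_nonneg_eq_0_iff[OF assms(1), of "\<lambda>a. \<pi> a b"] assms
    unfolding transport_plans_def by auto
qed

text \<open>A cost of the form \<open>f a - f b\<close> sees only the marginals of a plan, hence is
  the same for all plans.\<close>

lemma transport_plan_potential:
  assumes "\<pi> \<in> transport_plans V \<mu> \<nu>"
  shows "(\<Sum>a\<in>V. \<Sum>b\<in>V. \<pi> a b * (f a - f b)) = (\<Sum>a\<in>V. \<mu> a * f a) - (\<Sum>b\<in>V. \<nu> b * f b)"
proof -
  have "(\<Sum>a\<in>V. \<Sum>b\<in>V. \<pi> a b * (f a - f b))
      = (\<Sum>a\<in>V. (\<Sum>b\<in>V. \<pi> a b) * f a) - (\<Sum>a\<in>V. \<Sum>b\<in>V. \<pi> a b * f b)"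
    by (simp add: right_diff_distrib sum_subtractf sum_distrib_right)
  also have "(\<Sum>a\<in>V. \<Sum>b\<in>V. \<pi> a b * f b) = (\<Sum>b\<in>V. (\<Sum>a\<in>V. \<pi> a b) * f b)"
    by (subst sum.swap) (simp add: sum_distrib_right)
  finally show ?thesis using assms unfolding transport_plans_def by simp
qed

text \<open>Optimality certificate by complementary slackness: \<open>f\<close> bounds the cost of
  every plan from below, and the bound is attained by a plan charging only pairs where it is tight.
  The Lipschitz bound is asked only between the supports of \<mu> and \<nu>, since every plan
  vanishes on other pairs.\<close>

lemma transport_dist_eqI:
  assumes "finite V" and \<pi>: "\<pi> \<in> transport_plans V \<mu> \<nu>"
    and le: "\<And>a b. a \<in> V \<Longrightarrow> b \<in> V \<Longrightarrow> \<mu> a \<noteq> 0 \<Longrightarrow> \<nu> b \<noteq> 0 \<Longrightarrow> f a - f b \<le> d a b"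
    and eq: "\<And>a b. a \<in> V \<Longrightarrow> b \<in> V \<Longrightarrow> \<pi> a b \<noteq> 0 \<Longrightarrow> d a b = f a - f b"
  shows "transport_dist V d \<mu> \<nu> = (\<Sum>a\<in>V. \<mu> a * f a) - (\<Sum>b\<in>V. \<nu> b * f b)"
  unfolding transport_dist_def
proof (rule cInf_eq_minimum)
  have "(\<Sum>a\<in>V. \<mu> a * f a) - (\<Sum>b\<in>V. \<nu> b * f b) = (\<Sum>a\<in>V. \<Sum>b\<in>V. \<pi> a b * d a b)"
    unfolding transport_plan_potential[OF \<pi>, symmetric] using eq by (intro sum.cong) force+
  then show "(\<Sum>a\<in>V. \<mu> a * f a) - (\<Sum>b\<in>V. \<nu> b * f b)
      \<in> (\<lambda>\<pi>. \<Sum>a\<in>V. \<Sum>b\<in>V. \<pi> a b * d a b) ` transport_plans V \<mu> \<nu>"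
    using \<pi> by auto
  fix r assume "r \<in> (\<lambda>\<pi>. \<Sum>a\<in>V. \<Sum>b\<in>V. \<pi> a b * d a b) ` transport_plans V \<mu> \<nu>"
  then obtain \<rho> where \<rho>: "\<rho> \<in> transport_plans V \<mu> \<nu>"
    and r: "r = (\<Sum>a\<in>V. \<Sum>b\<in>V. \<rho> a b * d a b)" by blast
  have "\<rho> a b * (f a - f b) \<le> \<rho> a b * d a b" if "a \<in> V" "b \<in> V" for a b
  proof (cases "\<mu> a = 0 \<or> \<nu> b = 0")
    case True
    then show ?thesis using transport_plan_eq_0[OF assms(1) \<rho> that] by simp
  next
    case False
    moreover have "0 \<le> \<rho> a b" using \<rho> that unfolding transport_plans_def by auto
    ultimately show ?thesis using le[OF that] by (intro mult_left_mono) auto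
  qed
  then show "(\<Sum>a\<in>V. \<mu> a * f a) - (\<Sum>b\<in>V. \<nu> b * f b) \<le> r"
    unfolding transport_plan_potential[OF \<rho>, symmetric] r by (intro sum_mono)
qed

section \<open>Neighbourhoods and lazy measures\<close>

lemma finite_neighbours:
  assumes "fin_simple_graph V E" shows "finite (neighbours E x)"
proof (rule finite_subset)
  show "neighbours E x \<subseteq> V" "finite V"
    using assms unfolding fin_simple_graph_def neighbours_def by auto
qed

lemma edge_distinct:
  assumes "fin_simple_graph V E" "{x, y} \<in> E" shows "x \<noteq> y" "x \<in> V" "y \<in> V"
  using assms unfolding fin_simple_graph_def by fastforce+

lemma lazy_measure_eq_0:
  "y \<noteq> x \<Longrightarrow> y \<notin> neighbours E x \<Longrightarrow> lazy_measure E w \<alpha> x y = 0"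
  unfolding lazy_measure_def by simp

lemma inv_weight_sum_pos:
  assumes "fin_simple_graph V E" "edge_metric E w" "neighbours E x \<noteq> {}"
  shows "0 < inv_weight_sum E w x"
  unfolding inv_weight_sum_def using assms(2,3) finite_neighbours[OF assms(1)]
  by (intro sum_pos) (auto simp: neighbours_def edge_metric_def)

lemma lazy_measure_nonneg:
  assumes "fin_simple_graph V E" "edge_metric E w" "0 \<le> \<alpha>" "\<alpha> \<le> 1"
  shows "0 \<le> lazy_measure E w \<alpha> x y"
proof -
  have "0 \<le> inv_weight_sum E w x"
    unfolding inv_weight_sum_def using assms(2)
    by (intro sum_nonneg) (auto simp: neighbours_def edge_metric_def intro: less_imp_le)
  then show ?thesis
    unfolding lazy_measure_def using assms(2-4)
    by (auto simp: neighbours_def edge_metric_def intro!: mult_nonneg_nonneg divide_nonneg_nonneg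
          intro: less_imp_le)
qed

text \<open>The length cancels the weight \<open>1 / w {x, y}\<close>, so all neighbours add equal
  amounts to the transport cost. This is how the degrees enter the curvature.\<close>

lemma lazy_measure_neighbour_mass:
  assumes "fin_simple_graph V E" "edge_metric E w" "y \<in> neighbours E x"
  shows "lazy_measure E w \<alpha> x y * w {x, y} = (1 - \<alpha>) / inv_weight_sum E w x"
proof -
  have "{x, y} \<in> E" using assms(3) by (simp add: neighbours_def)
  then have "y \<noteq> x" "0 < w {x, y}"
    using edge_distinct[OF assms(1)] assms(2) by (auto simp: edge_metric_def)
  then show ?thesis using assms(3) by (simp add: lazy_measure_def)
qed

lemma lazy_measure_sum_restrict:
  assumes "fin_simple_graph V E" "x \<in> V"
  shows "(\<Sum>y\<in>V. lazy_measure E w \<alpha> x y * f y)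
    = \<alpha> * f x + (\<Sum>y\<in>neighbours E x. lazy_measure E w \<alpha> x y * f y)"
proof -
  have x: "x \<notin> neighbours E x"
    using edge_distinct(1)[OF assms(1), of x x] by (auto simp: neighbours_def)
  have "(\<Sum>y\<in>V. lazy_measure E w \<alpha> x y * f y)
      = (\<Sum>y\<in>insert x (neighbours E x). lazy_measure E w \<alpha> x y * f y)"
    using assms edge_distinct(3)[OF assms(1)]
    by (intro sum.mono_neutral_right)
       (auto simp: fin_simple_graph_def neighbours_def lazy_measure_def)
  also have "\<dots> = \<alpha> * f x + (\<Sum>y\<in>neighbours E x. lazy_measure E w \<alpha> x y * f y)"
    using x finite_neighbours[OF assms(1)] by (simp add: lazy_measure_def)
  finally show ?thesis .
qed

lemma lazy_measure_neighbours_sum: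
  assumes "fin_simple_graph V E" "edge_metric E w" "neighbours E x \<noteq> {}"
  shows "(\<Sum>y\<in>neighbours E x. lazy_measure E w \<alpha> x y) = 1 - \<alpha>"
proof -
  have "x \<notin> neighbours E x"
    using edge_distinct(1)[OF assms(1), of x x] by (auto simp: neighbours_def)
  then have "(\<Sum>y\<in>neighbours E x. lazy_measure E w \<alpha> x y)
      = (\<Sum>y\<in>neighbours E x. (1 - \<alpha>) / inv_weight_sum E w x * (1 / w {x, y}))"
    by (intro sum.cong) (auto simp: lazy_measure_def)
  also have "\<dots> = (1 - \<alpha>) / inv_weight_sum E w x * inv_weight_sum E w x"
    unfolding inv_weight_sum_def by (simp only: sum_distrib_left)
  also have "\<dots> = 1 - \<alpha>" using inv_weight_sum_pos[OF assms] by simp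
  finally show ?thesis .
qed

lemma lazy_measure_sum:
  assumes "fin_simple_graph V E" "edge_metric E w" "neighbours E x \<noteq> {}" "x \<in> V"
  shows "(\<Sum>y\<in>V. lazy_measure E w \<alpha> x y) = 1"
  using lazy_measure_sum_restrict[OF assms(1,4), where f = "\<lambda>_. 1"]
    lazy_measure_neighbours_sum[OF assms(1-3)] by simp

section \<open>Optimal transport across an edge of a tree\<close>

locale tree_edge =
  fixes V :: "'a set" and E :: "'a set set" and w :: "'a set \<Rightarrow> real" and u v :: 'a
  assumes graph: "fin_simple_graph V E" and acyclic: "acyclic_graph V E"
    and metric: "edge_metric E w" and edge: "{u, v} \<in> E"
begin

lemma uv: "u \<noteq> v" "u \<in> V" "v \<in> V" "0 < w {u, v}"
  using edge_distinct[OF graph edge] metric edge by (auto simp: edge_metric_def)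

lemma nbr: "v \<in> neighbours E u" "u \<in> neighbours E v"
  using edge by (auto simp: neighbours_def insert_commute)

text \<open>A common neighbour would close a triangle.\<close>

lemma neighbours_disjoint: "z \<in> neighbours E u \<Longrightarrow> z \<notin> neighbours E v"
proof
  assume z: "z \<in> neighbours E u" "z \<in> neighbours E v"
  then have e: "{z, u} \<in> E" "{v, z} \<in> E" by (auto simp: neighbours_def insert_commute)
  then have "simple_path V E [z, u, v]"
    using edge_distinct[OF graph e(1)] edge_distinct[OF graph e(2)] uv edge
    by (auto simp: simple_path_def)
  then show False using acyclic e(2) unfolding acyclic_graph_def by force
qed

text \<open>The signed distance to \<open>v\<close> near the edge, positive on the side of \<open>u\<close>: an optimal
  Kantorovich potential between the two lazy measures.\<close>

definition potential :: "'a \<Rightarrow> real" where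
  "potential a =
     (if a = v then 0
      else if a = u then w {u, v}
      else if a \<in> neighbours E u then w {u, v} + w {u, a}
      else - w {v, a})"

lemma dist_along_path:
  "simple_path V E p \<Longrightarrow> path_dist V E w (hd p) (last p) = sum_list (map w (path_edges p))"
  by (rule path_dist_eq[OF acyclic])

lemma near_u:
  assumes "a \<in> neighbours E u" "a \<noteq> v"
  shows "{a, u} \<in> E" "a \<in> V" "a \<noteq> u" "0 < w {a, u}" "a \<notin> neighbours E v"
  using assms(1) edge_distinct[OF graph, of a u] metric neighbours_disjoint[OF assms(1)]
  by (auto simp: neighbours_def insert_commute edge_metric_def)

lemma near_v:
  assumes "b \<in> neighbours E v" "b \<noteq> u"
  shows "{v, b} \<in> E" "b \<in> V" "b \<noteq> v" "0 < w {v, b}" "b \<notin> neighbours E u"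
  using assms(1) edge_distinct[OF graph, of v b] metric neighbours_disjoint[of b]
  by (auto simp: neighbours_def insert_commute edge_metric_def)

lemma dist_u_v: "path_dist V E w u v = w {u, v}"
  using dist_along_path[of "[u, v]"] uv edge by (auto simp: simple_path_def)

lemma dist_refl: "a \<in> V \<Longrightarrow> path_dist V E w a a = 0"
  using dist_along_path[of "[a]"] by (auto simp: simple_path_def)

text \<open>The plan below moves mass only into \<open>v\<close> or out of \<open>u\<close>. This
  lemma and \<open>dist_from_u\<close> make the potential tight on exactly those two kinds of
  pairs.\<close>

lemma dist_to_v:
  assumes "a \<in> insert u (neighbours E u)"
  shows "path_dist V E w a v = potential a"
proof -
  consider "a = v" | "a = u" | "a \<in> neighbours E u" "a \<noteq> v" "a \<noteq> u" using assms by blast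
  then show ?thesis
  proof cases
    case 1 then show ?thesis using dist_refl uv by (simp add: potential_def)
  next
    case 2 then show ?thesis using dist_u_v uv by (simp add: potential_def)
  next
    case 3
    then show ?thesis using dist_along_path[of "[a, u, v]"] near_u[OF 3(1,2)] uv edge
      by (auto simp: simple_path_def potential_def insert_commute)
  qed
qed

lemma dist_from_u:
  assumes "b \<in> insert v (neighbours E v)"
  shows "path_dist V E w u b = w {u, v} - potential b"
proof -
  consider "b = v" | "b = u" | "b \<in> neighbours E v" "b \<noteq> v" "b \<noteq> u" using assms by blast
  then show ?thesis
  proof cases
    case 1 then show ?thesis using dist_u_v by (simp add: potential_def)
  next
    case 2 then show ?thesis using dist_refl uv by (simp add: potential_def)
  next
    case 3
    then show ?thesis using dist_along_path[of "[u, v, b]"] near_v[OF 3(1,3)] uv edge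
      by (auto simp: simple_path_def potential_def)
  qed
qed

text \<open>The path from \<open>a\<close> to \<open>b\<close> is explicit in each case. Equality
  holds in all of them except \<open>a = v\<close>, \<open>b = u\<close>, where the edge is crossed
  backwards and the left side is \<open>- w {u, v}\<close>.\<close>

lemma potential_le_dist:
  assumes a: "a \<in> insert u (neighbours E u)" and b: "b \<in> insert v (neighbours E v)"
  shows "potential a - potential b \<le> path_dist V E w a b"
proof -
  consider "a = u" | "b = v" | "a = v" "b = u" | "a = v" "b \<in> neighbours E v" "b \<noteq> u"
    | "a \<in> neighbours E u" "a \<noteq> v" "b = u"
    | "a \<in> neighbours E u" "a \<noteq> v" "b \<in> neighbours E v" "b \<noteq> u" using a b by blast
  then show ?thesis
  proof cases
    case 1 then show ?thesis using dist_from_u[OF b] uv by (simp add: potential_def)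
  next
    case 2 then show ?thesis using dist_to_v[OF a] by (simp add: potential_def)
  next
    case 3
    then show ?thesis using dist_along_path[of "[v, u]"] uv edge
      by (auto simp: simple_path_def potential_def insert_commute)
  next
    case 4
    then show ?thesis using 4 dist_along_path[of "[v, b]"] near_v[OF 4(2,3)] uv
      by (auto simp: simple_path_def potential_def)
  next
    case 5
    then show ?thesis using 5 dist_along_path[of "[a, u]"] near_u[OF 5(1,2)] uv
      by (auto simp: simple_path_def potential_def insert_commute)
  next
    case 6
    then have "a \<noteq> b" using near_u by blast
    then show ?thesis
      using 6 dist_along_path[of "[a, u, v, b]"] near_u[OF 6(1,2)] near_v[OF 6(3,4)] uv edge
      by (auto simp: simple_path_def potential_def insert_commute)
  qed
qed

text \<open>The mass \<open>2\<alpha> - 1 = \<alpha> - (1 - \<alpha>)\<close> is what remains at \<open>u\<close> once the neighbours of \<open>v\<close> are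
  supplied.\<close>

definition plan :: "real \<Rightarrow> 'a \<Rightarrow> 'a \<Rightarrow> real" where
  "plan \<alpha> a b =
     (if b = v then (if a = u then 2 * \<alpha> - 1 else lazy_measure E w \<alpha> u a)
      else if a = u then lazy_measure E w \<alpha> v b
      else 0)"

lemma plan_transport:
  assumes "1 / 2 \<le> \<alpha>" "\<alpha> \<le> 1"
  shows "plan \<alpha> \<in> transport_plans V (lazy_measure E w \<alpha> u) (lazy_measure E w \<alpha> v)"
proof -
  let ?\<mu> = "lazy_measure E w \<alpha> u" and ?\<nu> = "lazy_measure E w \<alpha> v"
  have fin: "finite V" using graph by (simp add: fin_simple_graph_def)
  have "sum ?\<mu> V = 1" "sum ?\<nu> V = 1"
    using lazy_measure_sum[OF graph metric] nbr uv by blast+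
  moreover have "?\<mu> u = \<alpha>" "?\<nu> v = \<alpha>" by (simp_all add: lazy_measure_def)
  ultimately have rest: "sum ?\<mu> (V - {u}) = 1 - \<alpha>" "sum ?\<nu> (V - {v}) = 1 - \<alpha>"
    using fin uv by (simp_all add: sum_diff1)
  have row: "(\<Sum>b\<in>V. plan \<alpha> a b) = ?\<mu> a" for a
  proof (cases "a = u")
    case True
    have "(\<Sum>b\<in>V. plan \<alpha> u b) = plan \<alpha> u v + (\<Sum>b\<in>V - {v}. plan \<alpha> u b)"
      using fin uv by (intro sum.remove) auto
    also have "(\<Sum>b\<in>V - {v}. plan \<alpha> u b) = sum ?\<nu> (V - {v})"
      by (intro sum.cong) (auto simp: plan_def)
    finally show ?thesis using rest True \<open>?\<mu> u = \<alpha>\<close> by (simp add: plan_def)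
  next
    case False
    then have "(\<Sum>b\<in>V. plan \<alpha> a b) = (\<Sum>b\<in>V. if b = v then ?\<mu> a else 0)"
      by (intro sum.cong) (auto simp: plan_def)
    then show ?thesis using fin uv by simp
  qed
  have col: "(\<Sum>a\<in>V. plan \<alpha> a b) = ?\<nu> b" for b
  proof (cases "b = v")
    case True
    have "(\<Sum>a\<in>V. plan \<alpha> a v) = plan \<alpha> u v + (\<Sum>a\<in>V - {u}. plan \<alpha> a v)"
      using fin uv by (intro sum.remove) auto
    also have "(\<Sum>a\<in>V - {u}. plan \<alpha> a v) = sum ?\<mu> (V - {u})"
      by (intro sum.cong) (auto simp: plan_def)
    finally show ?thesis using rest True \<open>?\<nu> v = \<alpha>\<close> by (simp add: plan_def)
  next
    case False
    then have "(\<Sum>a\<in>V. plan \<alpha> a b) = (\<Sum>a\<in>V. if a = u then ?\<nu> b else 0)"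
      by (intro sum.cong) (auto simp: plan_def)
    then show ?thesis using fin uv by simp
  qed
  \<comment> \<open>The bound \<open>1 / 2 \<le> \<alpha>\<close> makes the entry
    \<open>2 * \<alpha> - 1\<close> at \<open>(u, v)\<close> nonnegative.\<close>
  have "0 \<le> plan \<alpha> a b" for a b
    unfolding plan_def using lazy_measure_nonneg[OF graph metric] assms by simp
  then show ?thesis using row col by (simp add: transport_plans_def)
qed

lemma transport_dist_eq:
  assumes "1 / 2 \<le> \<alpha>" "\<alpha> \<le> 1"
  shows "transport_dist V (path_dist V E w) (lazy_measure E w \<alpha> u) (lazy_measure E w \<alpha> v)
    = (\<Sum>a\<in>V. lazy_measure E w \<alpha> u a * potential a)
      - (\<Sum>b\<in>V. lazy_measure E w \<alpha> v b * potential b)"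
proof (rule transport_dist_eqI[OF _ plan_transport[OF assms]])
  show "finite V" using graph by (simp add: fin_simple_graph_def)
  show "potential a - potential b \<le> path_dist V E w a b"
    if "lazy_measure E w \<alpha> u a \<noteq> 0" "lazy_measure E w \<alpha> v b \<noteq> 0" for a b
    using that lazy_measure_eq_0[of a u E] lazy_measure_eq_0[of b v E]
    by (intro potential_le_dist) blast+
  show "path_dist V E w a b = potential a - potential b" if "plan \<alpha> a b \<noteq> 0" for a b
  proof (cases "b = v")
    case True
    then have "a \<in> insert u (neighbours E u)"
      using that lazy_measure_eq_0[of a u E] by (cases "a = u") (auto simp: plan_def)
    then show ?thesis using dist_to_v True by (simp add: potential_def)
  next
    case False
    then have "a = u" "b \<in> insert v (neighbours E v)"
      using that lazy_measure_eq_0[of b v E] by (auto simp: plan_def split: if_splits)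
    then show ?thesis using dist_from_u uv by (simp add: potential_def)
  qed
qed

lemma potential_sum_u:
  "(\<Sum>a\<in>V. lazy_measure E w \<alpha> u a * potential a)
    = w {u, v} + (1 - \<alpha>) * ((real (deg E u) - 2) / inv_weight_sum E w u)"
proof -
  let ?\<mu> = "lazy_measure E w \<alpha> u" and ?D = "inv_weight_sum E w u" and ?N = "neighbours E u"
  have fin: "finite ?N" by (rule finite_neighbours[OF graph])
  have u: "u \<notin> ?N" using edge_distinct(1)[OF graph, of u u] by (auto simp: neighbours_def)
  \<comment> \<open>Each neighbour is treated as if its potential were
    \<open>w {u, v} + w {u, a}\<close>. For \<open>a = v\<close> this gives
    \<open>2 * w {u, v}\<close> in place of 0, and the \<open>if\<close> term corrects the
    excess.\<close>
  have "(\<Sum>a\<in>?N. ?\<mu> a * potential a)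
      = (\<Sum>a\<in>?N. ?\<mu> a * w {u, v} + (if a = v then - (2 * ((1 - \<alpha>) / ?D)) else 0) + (1 - \<alpha>) / ?D)"
    using lazy_measure_neighbour_mass[OF graph metric] u uv
    by (intro sum.cong) (auto simp: potential_def distrib_left)
  also have "\<dots> = (\<Sum>a\<in>?N. ?\<mu> a) * w {u, v} - 2 * ((1 - \<alpha>) / ?D) + real (deg E u) * ((1 - \<alpha>) / ?D)"
    using fin nbr by (simp add: sum.distrib deg_def flip: sum_distrib_right)
  also have "(\<Sum>a\<in>?N. ?\<mu> a) = 1 - \<alpha>"
    using nbr by (intro lazy_measure_neighbours_sum[OF graph metric]) auto
  finally show ?thesis
    using uv unfolding lazy_measure_sum_restrict[OF graph uv(2)]
    by (simp add: potential_def algebra_simps diff_divide_distrib)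
qed

lemma potential_sum_v:
  "(\<Sum>b\<in>V. lazy_measure E w \<alpha> v b * potential b)
    = - ((1 - \<alpha>) * ((real (deg E v) - 2) / inv_weight_sum E w v))"
proof -
  let ?\<nu> = "lazy_measure E w \<alpha> v" and ?D = "inv_weight_sum E w v" and ?N = "neighbours E v"
  have fin: "finite ?N" by (rule finite_neighbours[OF graph])
  have v: "v \<notin> ?N" using edge_distinct(1)[OF graph, of v v] by (auto simp: neighbours_def)
  \<comment> \<open>Here \<open>u\<close> is the exceptional neighbour: its potential is
    \<open>w {u, v}\<close> and not \<open>- w {u, v}\<close>.\<close>
  have "(\<Sum>b\<in>?N. ?\<nu> b * potential b)
      = (\<Sum>b\<in>?N. (if b = u then 2 * ((1 - \<alpha>) / ?D) else 0) - (1 - \<alpha>) / ?D)"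
    using lazy_measure_neighbour_mass[OF graph metric, of _ v] v uv neighbours_disjoint
    by (intro sum.cong) (auto simp: potential_def insert_commute)
  also have "\<dots> = 2 * ((1 - \<alpha>) / ?D) - real (deg E v) * ((1 - \<alpha>) / ?D)"
    using fin nbr by (simp add: sum_subtractf deg_def)
  finally show ?thesis
    unfolding lazy_measure_sum_restrict[OF graph uv(3)]
    by (simp add: potential_def algebra_simps diff_divide_distrib)
qed

theorem lly_curvature_eq:
  "lly_curvature V E w u v * w {u, v}
    = (2 - real (deg E u)) / inv_weight_sum E w u + (2 - real (deg E v)) / inv_weight_sum E w v"
proof -
  let ?S = "(2 - real (deg E u)) / inv_weight_sum E w u
    + (2 - real (deg E v)) / inv_weight_sum E w v"
  \<comment> \<open>The quotient is already constant in \<alpha> on the interval from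
    \<open>1 / 2\<close> to 1, so the limit is its value there.\<close>
  have "lazy_curvature V E w \<alpha> u v / (1 - \<alpha>) = ?S / w {u, v}" if "1 / 2 \<le> \<alpha>" "\<alpha> < 1" for \<alpha>
  proof -
    have "transport_dist V (path_dist V E w) (lazy_measure E w \<alpha> u) (lazy_measure E w \<alpha> v)
        = w {u, v} - (1 - \<alpha>) * ?S"
      unfolding transport_dist_eq[OF that(1) less_imp_le[OF that(2)]]
        potential_sum_u potential_sum_v
      by (simp add: algebra_simps diff_divide_distrib)
    then have "lazy_curvature V E w \<alpha> u v = (1 - \<alpha>) * ?S / w {u, v}"
      unfolding lazy_curvature_def dist_u_v using uv by (simp add: diff_divide_distrib)
    then show ?thesis using that by simp
  qed
  then have "eventually (\<lambda>\<alpha>. lazy_curvature V E w \<alpha> u v / (1 - \<alpha>) = ?S / w {u, v}) (at_left 1)"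
    by (intro eventually_at_leftI[of "1 / 2"]) auto
  then have "((\<lambda>\<alpha>. lazy_curvature V E w \<alpha> u v / (1 - \<alpha>)) \<longlongrightarrow> ?S / w {u, v}) (at_left 1)"
    by (rule tendsto_eventually)
  then have "lly_curvature V E w u v = ?S / w {u, v}"
    unfolding lly_curvature_def by (intro tendsto_Lim) auto
  then show ?thesis using uv by simp
qed

end

section \<open>The lengths of the edges at a vertex under the flow\<close>


text \<open>Gronwall argument with integrating factor \<open>exp (b * t)\<close>: the function
  \<open>g\<close> is nondecreasing, so \<open>s\<close> is at least \<open>a / b\<close> up to an
  exponentially small term. Halving \<open>a / b\<close> leaves room to absorb that term.\<close>

lemma deriv_lower_bound_at_top:
  fixes s s' :: "real \<Rightarrow> real"
  assumes s: "\<And>t. T \<le> t \<Longrightarrow> (s has_real_derivative s' t) (at t)"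
    and bound: "\<And>t. T \<le> t \<Longrightarrow> a - b * s t \<le> s' t"
    and "0 < a" "0 < b"
  shows "eventually (\<lambda>t. a / (2 * b) < s t) at_top"
proof -
  define g where "g t = (s t - a / b) * exp (b * t)" for t
  have mono: "g T \<le> g t" if "T \<le> t" for t
  proof (rule DERIV_nonneg_imp_nondecreasing[OF that])
    fix r assume r: "T \<le> r" "r \<le> t"
    have "(g has_real_derivative (s' r + b * s r - a) * exp (b * r)) (at r)"
      unfolding g_def using \<open>0 < b\<close>
      by (auto intro!: derivative_eq_intros s[OF r(1)] simp: field_simps)
    moreover have "0 \<le> (s' r + b * s r - a) * exp (b * r)"
      using bound[OF r(1)] by simp
    ultimately show "\<exists>y. (g has_real_derivative y) (at r) \<and> 0 \<le> y" by blast
  qed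
  have "((\<lambda>t. a / b + g T * exp (- (b * t))) \<longlongrightarrow> a / b + g T * 0) at_top"
    using \<open>0 < b\<close>
    by (intro tendsto_intros filterlim_compose[OF exp_at_bot])
       (auto simp: filterlim_uminus_at_bot
          intro: filterlim_tendsto_pos_mult_at_top[OF tendsto_const _ filterlim_ident])
  moreover have "a / (2 * b) < a / b + g T * 0" using assms(3,4) by (simp add: field_simps)
  ultimately have "eventually (\<lambda>t. a / (2 * b) < a / b + g T * exp (- (b * t))) at_top"
    by (rule order_tendstoD)
  then show ?thesis using eventually_ge_at_top[of T]
  proof eventually_elim
    case (elim t)
    have "g T * exp (- (b * t)) \<le> g t * exp (- (b * t))"
      using mono[OF elim(2)] by simp
    also have "\<dots> = s t - a / b" by (simp add: g_def exp_minus)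
    finally show ?case using elim(1) by linarith
  qed
qed

text \<open>The flow as seen from one vertex \<open>u\<close>: \<open>N\<close> stands for its
  neighbours, \<open>L\<close> for those of degree 1, \<open>x z\<close> for the length of the edge
  to \<open>z\<close>, and \<open>c\<close> for \<open>d - 2\<close>. For inner edges only a lower
  bound on the derivative is kept, because the term from the far endpoint is nonnegative but
  involves edges away from \<open>u\<close>.\<close>

locale vertex_flow =
  fixes N L :: "'a set" and x :: "'a \<Rightarrow> real \<Rightarrow> real" and v :: 'a and c :: real
  assumes finite_N: "finite N" and L_subset: "L \<subseteq> N" and v_in: "v \<in> L" and c_pos: "0 < c"
    and pos: "\<And>z t. z \<in> N \<Longrightarrow> 0 < t \<Longrightarrow> 0 < x z t"
    and leaf_deriv: "\<And>z t. z \<in> L \<Longrightarrow> 0 < t \<Longrightarrow>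
      (x z has_real_derivative c / (\<Sum>y\<in>N. 1 / x y t) - x z t) (at t)"
    and inner_deriv: "\<And>z t. z \<in> N - L \<Longrightarrow> 0 < t \<Longrightarrow>
      \<exists>D. (x z has_real_derivative D) (at t) \<and> c / (\<Sum>y\<in>N. 1 / x y t) \<le> D"
begin

definition X :: "real \<Rightarrow> real" where "X t = (\<Sum>z\<in>N. x v t / x z t)"

definition G :: "real \<Rightarrow> real" where "G t = c / X t"

definition y :: "'a \<Rightarrow> real \<Rightarrow> real" where "y z t = x z t * exp t"

lemma v_in_N: "v \<in> N" using L_subset v_in by blast

lemma X_pos: "0 < t \<Longrightarrow> 0 < X t"
  unfolding X_def using finite_N v_in_N pos by (intro sum_pos) auto

lemma G_pos: "0 < t \<Longrightarrow> 0 < G t"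
  unfolding G_def using X_pos c_pos by simp

lemma y_pos: "z \<in> N \<Longrightarrow> 0 < t \<Longrightarrow> 0 < y z t"
  unfolding y_def using pos by simp

lemma X_eq: "X t = (\<Sum>z\<in>N. y v t / y z t)"
  unfolding X_def y_def by simp

lemma influx_eq: "0 < t \<Longrightarrow> c / (\<Sum>z\<in>N. 1 / x z t) = G t * x v t"
proof -
  assume t: "0 < t"
  have "X t = x v t * (\<Sum>z\<in>N. 1 / x z t)"
    unfolding X_def by (simp add: sum_distrib_left)
  then show ?thesis unfolding G_def using pos[OF v_in_N t] by simp
qed

section \<open>Growth of the rescaled lengths\<close>

lemma y_leaf_deriv:
  assumes "z \<in> L" "0 < t"
  shows "(y z has_real_derivative G t * y v t) (at t)"
  unfolding y_def
  using leaf_deriv[OF assms] unfolding influx_eq[OF assms(2)]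
  by (auto intro!: derivative_eq_intros simp: algebra_simps)

text \<open>An inner edge lacks the decay term \<open>- x z t\<close> of a leaf edge, so rescaling
  by \<open>exp t\<close> leaves the additional growth \<open>y z t\<close>.\<close>

lemma y_inner_deriv:
  assumes "z \<in> N - L" "0 < t"
  shows "\<exists>D. (y z has_real_derivative D) (at t) \<and> G t * y v t + y z t \<le> D"
proof -
  obtain D where D: "(x z has_real_derivative D) (at t)" "G t * x v t \<le> D"
    using inner_deriv[OF assms] unfolding influx_eq[OF assms(2)] by blast
  have "(y z has_real_derivative (D + x z t) * exp t) (at t)"
    unfolding y_def using D(1) by (auto intro!: derivative_eq_intros simp: algebra_simps)
  moreover have "G t * y v t + y z t \<le> (D + x z t) * exp t"
    using D(2) unfolding y_def by (simp add: algebra_simps)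
  ultimately show ?thesis by blast
qed

lemma y_deriv_ge:
  assumes "z \<in> N" "0 < t"
  shows "\<exists>D. (y z has_real_derivative D) (at t) \<and> G t * y v t \<le> D"
proof (cases "z \<in> L")
  case True
  then show ?thesis using y_leaf_deriv[OF True assms(2)] by blast
next
  case False
  then show ?thesis
    using y_inner_deriv[of z t] assms y_pos[OF assms] by fastforce
qed

text \<open>Time 1 serves as base point from here on, as the derivatives are given only at positive
  times.\<close>

lemma y_ge:
  assumes "z \<in> N" "1 \<le> t"
  shows "y z 1 \<le> y z t"
proof (rule DERIV_nonneg_imp_nondecreasing[OF assms(2)])
  fix r :: real assume r: "1 \<le> r" "r \<le> t"
  then have "0 \<le> G r * y v r" using G_pos y_pos[OF v_in_N] by (simp add: less_imp_le)
  then show "\<exists>D. (y z has_real_derivative D) (at r) \<and> 0 \<le> D"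
    using y_deriv_ge[OF assms(1), of r] r(1) by force
qed

text \<open>Every edge at the vertex grows at least at the rate \<open>G t * y v t\<close>, which is
  the exact rate for \<open>v\<close>.\<close>

lemma y_diff_ge:
  assumes "z \<in> N" "1 \<le> t"
  shows "y z 1 - y v 1 \<le> y z t - y v t"
proof (rule DERIV_nonneg_imp_nondecreasing[OF assms(2)])
  fix r :: real assume r: "1 \<le> r" "r \<le> t"
  obtain D where "(y z has_real_derivative D) (at r)" "G r * y v r \<le> D"
    using y_deriv_ge[OF assms(1), of r] r(1) by force
  then show "\<exists>D. ((\<lambda>t. y z t - y v t) has_real_derivative D) (at r) \<and> 0 \<le> D"
    using DERIV_diff[OF _ y_leaf_deriv[OF v_in, of r]] r(1) by force
qed

lemma y_leaf_diff:
  assumes "z \<in> L" "1 \<le> t"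
  shows "y z t - y v t = y z 1 - y v 1"
\<comment> \<open>The right end \<open>t + 1\<close> keeps the interval nondegenerate when
  \<open>t = 1\<close>.\<close>
proof (rule DERIV_isconst2[of 1 "t + 1"])
  have "isCont (y z) r \<and> isCont (y v) r" if "r \<in> {1..t + 1}" for r
    using DERIV_isCont[OF y_leaf_deriv[OF assms(1), of r]] DERIV_isCont[OF y_leaf_deriv[OF v_in, of r]]
      that by simp
  then show "continuous_on {1..t + 1} (\<lambda>t. y z t - y v t)"
    by (auto intro: continuous_at_imp_continuous_on)
  show "((\<lambda>t. y z t - y v t) has_real_derivative 0) (at r)" if "1 < r" "r < t + 1" for r
    using DERIV_diff[OF y_leaf_deriv[OF assms(1), of r] y_leaf_deriv[OF v_in, of r]] that
    by simp
qed (use assms in auto)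

text \<open>The excess of \<open>y v\<close> over \<open>y z\<close> never grows, and
  \<open>y z\<close> stays above \<open>y z 1 > 0\<close>, so each ratio
  \<open>y v t / y z t\<close> is bounded.\<close>

lemma X_bounded: "\<exists>B>0. \<forall>t\<ge>1. X t \<le> B"
proof -
  have ratio: "\<exists>B. \<forall>t\<ge>1. y v t / y z t \<le> B" if z: "z \<in> N" for z
  proof (intro exI allI impI)
    fix t :: real assume t: "1 \<le> t"
    have m: "0 < y z 1" "0 < y z t" using y_pos[OF z] t by auto
    have "\<bar>y v 1 - y z 1\<bar> * y z 1 \<le> \<bar>y v 1 - y z 1\<bar> * y z t"
      using y_ge[OF z t] by (intro mult_left_mono) auto
    then have "\<bar>y v 1 - y z 1\<bar> \<le> \<bar>y v 1 - y z 1\<bar> / y z 1 * y z t"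
      using m by (simp add: field_simps)
    moreover have "y v t \<le> y z t + \<bar>y v 1 - y z 1\<bar>"
      using y_diff_ge[OF z t] by linarith
    ultimately have "y v t \<le> (1 + \<bar>y v 1 - y z 1\<bar> / y z 1) * y z t"
      by (simp add: algebra_simps)
    then show "y v t / y z t \<le> 1 + \<bar>y v 1 - y z 1\<bar> / y z 1"
      using m by (simp add: divide_le_eq)
  qed
  then obtain B where B: "\<And>z t. z \<in> N \<Longrightarrow> 1 \<le> t \<Longrightarrow> y v t / y z t \<le> B z" by metis
  have le: "X t \<le> sum B N" if "1 \<le> t" for t
    unfolding X_eq using B that by (intro sum_mono) auto
  moreover have "0 < sum B N" using X_pos[of 1] le[of 1] by simp
  ultimately show ?thesis by blast
qed

lemma G_lower_bound: "\<exists>\<delta>>0. \<forall>t\<ge>1. \<delta> \<le> G t"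
proof -
  obtain B where B: "0 < B" "\<And>t. 1 \<le> t \<Longrightarrow> X t \<le> B" using X_bounded by blast
  have "c / B \<le> G t" if "1 \<le> t" for t
    unfolding G_def using B(2)[OF that] X_pos[of t] that c_pos by (simp add: frac_le)
  moreover have "0 < c / B" using c_pos B(1) by simp
  ultimately show ?thesis by blast
qed

lemma y_at_top: "filterlim (y v) at_top at_top"
proof -
  obtain \<delta> where \<delta>: "0 < \<delta>" "\<And>t. 1 \<le> t \<Longrightarrow> \<delta> \<le> G t" using G_lower_bound by blast
  \<comment> \<open>The derivative \<open>G t * y v t\<close> is at least this constant, so
    \<open>y v\<close> grows at least linearly.\<close>
  define k where "k = \<delta> * y v 1"
  have k: "0 < k" unfolding k_def using \<delta>(1) y_pos[OF v_in_N, of 1] by simp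
  have "y v 1 - k * 1 \<le> y v t - k * t" if t: "1 \<le> t" for t
  proof (rule DERIV_nonneg_imp_nondecreasing[OF t])
    fix r :: real assume r: "1 \<le> r" "r \<le> t"
    have "k \<le> G r * y v r"
      unfolding k_def using \<delta> r(1) y_ge[OF v_in_N r(1)] y_pos[OF v_in_N, of 1]
      by (intro mult_mono) (auto intro: less_imp_le order_trans[OF less_imp_le[OF \<delta>(1)]])
    then show "\<exists>D. ((\<lambda>t. y v t - k * t) has_real_derivative D) (at r) \<and> 0 \<le> D"
      using y_leaf_deriv[OF v_in, of r] r(1)
      by (intro exI[of _ "G r * y v r - k"]) (auto intro!: derivative_eq_intros)
  qed
  then have "eventually (\<lambda>t. (y v 1 - k) + k * t \<le> y v t) at_top"
    by (intro eventually_at_top_linorderI[of 1]) fastforce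
  moreover have "filterlim (\<lambda>t. (y v 1 - k) + k * t) at_top at_top"
    by (intro filterlim_tendsto_add_at_top[OF tendsto_const]
          filterlim_tendsto_pos_mult_at_top[OF tendsto_const k filterlim_ident])
  ultimately show ?thesis by (rule filterlim_at_top_mono[rotated])
qed

section \<open>Asymptotics of the length ratios and of \<open>G\<close>\<close>

text \<open>The difference of two rescaled leaf lengths is constant while \<open>y v\<close> tends
  to infinity.\<close>

lemma leaf_ratio_tendsto:
  assumes z: "z \<in> L"
  shows "((\<lambda>t. y v t / y z t) \<longlongrightarrow> 1) at_top"
proof -
  define k where "k = y z 1 - y v 1"
  have "((\<lambda>t. 1 / (1 + k / y v t)) \<longlongrightarrow> 1 / (1 + 0)) at_top"
    by (intro tendsto_intros tendsto_divide_0[OF tendsto_const]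
          filterlim_at_top_imp_at_infinity y_at_top) simp
  moreover have "eventually (\<lambda>t. 1 / (1 + k / y v t) = y v t / y z t) at_top"
    using eventually_ge_at_top[of 1]
  proof eventually_elim
    case (elim t)
    then have "y z t = y v t + k" using y_leaf_diff[OF z elim] unfolding k_def by simp
    moreover have "0 < y v t" using y_pos[OF v_in_N] elim by simp
    ultimately show ?case by (simp add: field_simps)
  qed
  ultimately show ?thesis by (simp add: tendsto_cong)
qed

lemma leaf_sum_tendsto: "((\<lambda>t. \<Sum>z\<in>L. y v t / y z t) \<longlongrightarrow> real (card L)) at_top"
proof -
  have "((\<lambda>t. \<Sum>z\<in>L. y v t / y z t) \<longlongrightarrow> (\<Sum>z\<in>L. 1)) at_top"
    by (intro tendsto_sum leaf_ratio_tendsto)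
  then show ?thesis by simp
qed

lemma card_L_pos: "0 < card L"
  using finite_subset[OF L_subset finite_N] v_in by (auto simp: card_gt_0_iff)

text \<open>For the ratio \<open>s = y z / y v\<close> the quotient rule gives
  \<open>s' \<ge> G + (1 - G) * s\<close>. Once \<open>G < 1 + \<epsilon>\<close>, this is at least
  \<open>\<delta> - \<epsilon> * s\<close>, which drives \<open>s\<close> above
  \<open>\<delta> / (2 * \<epsilon>)\<close>.\<close>

lemma inner_ratio_at_top:
  assumes z: "z \<in> N - L" and G: "\<And>\<epsilon>. 0 < \<epsilon> \<Longrightarrow> eventually (\<lambda>t. G t < 1 + \<epsilon>) at_top"
  shows "filterlim (\<lambda>t. y z t / y v t) at_top at_top"
proof -
  obtain \<delta> where \<delta>: "0 < \<delta>" "\<And>t. 1 \<le> t \<Longrightarrow> \<delta> \<le> G t" using G_lower_bound by blast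
  have "eventually (\<lambda>t. K < y z t / y v t) at_top" if K: "0 < K" for K
  proof -
    \<comment> \<open>Chosen so that \<open>\<delta> / (2 * \<epsilon>) = K\<close>.\<close>
    define \<epsilon> where "\<epsilon> = \<delta> / (2 * K)"
    have \<epsilon>: "0 < \<epsilon>" unfolding \<epsilon>_def using \<delta>(1) K by simp
    obtain T where T: "\<And>t. T \<le> t \<Longrightarrow> G t < 1 + \<epsilon>"
      using G[OF \<epsilon>] unfolding eventually_at_top_linorder by blast
    have "\<exists>D. ((\<lambda>t. y z t / y v t) has_real_derivative D) (at t) \<and>
        \<delta> - \<epsilon> * (y z t / y v t) \<le> D" if t: "max T 1 \<le> t" for t
    proof -
      have p: "0 < y v t" "0 < y z t" using y_pos[of _ t] v_in_N z t by auto
      obtain D where D: "(y z has_real_derivative D) (at t)" "G t * y v t + y z t \<le> D"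
        using y_inner_deriv[OF z, of t] t by auto
      have "((\<lambda>t. y z t / y v t) has_real_derivative
          (D * y v t - y z t * (G t * y v t)) / (y v t * y v t)) (at t)"
        using DERIV_divide[OF D(1) y_leaf_deriv[OF v_in]] p t by simp
      moreover have "(D * y v t - y z t * (G t * y v t)) / (y v t * y v t)
          = D / y v t - G t * (y z t / y v t)"
        using p by (simp add: field_simps)
      moreover have "G t + y z t / y v t \<le> D / y v t"
        using divide_right_mono[OF D(2), of "y v t"] p by (simp add: add_divide_distrib)
      moreover have "G t * (y z t / y v t) \<le> y z t / y v t + \<epsilon> * (y z t / y v t)"
        using mult_right_mono[of "G t" "1 + \<epsilon>" "y z t / y v t"] T[of t] t p
        unfolding distrib_right by simp
      moreover have "\<delta> \<le> G t" using \<delta>(2) t by simp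
      ultimately show ?thesis
        by (intro exI[of _ "D / y v t - G t * (y z t / y v t)"] conjI) (simp only:, linarith)
    qed
    then obtain s' where "\<And>t. max T 1 \<le> t \<Longrightarrow>
        ((\<lambda>t. y z t / y v t) has_real_derivative s' t) (at t)"
      "\<And>t. max T 1 \<le> t \<Longrightarrow> \<delta> - \<epsilon> * (y z t / y v t) \<le> s' t" by metis
    then have "eventually (\<lambda>t. \<delta> / (2 * \<epsilon>) < y z t / y v t) at_top"
      using \<delta>(1) \<epsilon> by (rule deriv_lower_bound_at_top)
    then show ?thesis unfolding \<epsilon>_def using \<delta>(1) K by simp
  qed
  then show ?thesis
    unfolding filterlim_at_top_gt[where c = 0] by (blast intro: eventually_mono less_imp_le)
qed

lemma X_split: "X t = (\<Sum>z\<in>L. y v t / y z t) + (\<Sum>z\<in>N - L. y v t / y z t)"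
  unfolding X_eq using sum.subset_diff[OF L_subset finite_N] by (simp add: add.commute)

text \<open>In the sum \<open>X\<close> each leaf edge contributes 1 in the limit and each inner
  edge 0.\<close>

lemma G_tendsto:
  assumes G: "\<And>\<epsilon>. 0 < \<epsilon> \<Longrightarrow> eventually (\<lambda>t. G t < 1 + \<epsilon>) at_top"
  shows "(G \<longlongrightarrow> c / card L) at_top"
proof -
  have "((\<lambda>t. y v t / y z t) \<longlongrightarrow> 0) at_top" if "z \<in> N - L" for z
    using tendsto_inverse_0_at_top[OF inner_ratio_at_top[OF that G]] by simp
  then have "((\<lambda>t. \<Sum>z\<in>N - L. y v t / y z t) \<longlongrightarrow> (\<Sum>z\<in>N - L. 0)) at_top"
    by (intro tendsto_sum)
  from tendsto_add[OF leaf_sum_tendsto this]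
  have "(X \<longlongrightarrow> card L) at_top" by (simp add: X_split[abs_def])
  then show ?thesis
    unfolding G_def using card_L_pos by (intro tendsto_intros) auto
qed

text \<open>The leaf part of \<open>X\<close> alone tends to \<open>card L\<close>, which is at
  least \<open>c\<close>. The inner edges only enlarge \<open>X\<close>, hence only lower
  \<open>G\<close>.\<close>

lemma G_eventually_less:
  assumes "c \<le> card L" "0 < \<epsilon>"
  shows "eventually (\<lambda>t. G t < 1 + \<epsilon>) at_top"
proof -
  have "c < (1 + \<epsilon>) * card L"
    using assms(1) mult_pos_pos[OF assms(2), of "real (card L)"] card_L_pos
    unfolding distrib_right by linarith
  then have "eventually (\<lambda>t. c / (1 + \<epsilon>) < (\<Sum>z\<in>L. y v t / y z t)) at_top"
    using assms(2) by (intro order_tendstoD(1)[OF leaf_sum_tendsto]) (simp add: field_simps)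
  then show ?thesis using eventually_gt_at_top[of 0]
  proof eventually_elim
    case (elim t)
    have "0 \<le> (\<Sum>z\<in>N - L. y v t / y z t)"
      using y_pos[of _ t] v_in_N elim(2) by (intro sum_nonneg) (auto intro: less_imp_le)
    then have "c / (1 + \<epsilon>) < X t" unfolding X_split using elim(1) by linarith
    then show ?case
      unfolding G_def using X_pos[OF elim(2)] assms(2) by (simp add: field_simps)
  qed
qed

end

section \<open>The limit of the curvature\<close>

text \<open>Since \<open>u\<close> does not have degree 1, the endpoint that makes an edge at
  \<open>u\<close> a leaf edge is the other one.\<close>

lemma leaf_deg_eq:
  assumes "fin_simple_graph V E" "deg E u \<noteq> 1"
  shows "leaf_deg E u = card {z \<in> neighbours E u. deg E z = 1}"
proof -
  have "{h. leaf_edge E h \<and> u \<in> h} = (\<lambda>z. {u, z}) ` {z \<in> neighbours E u. deg E z = 1}"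
  proof (intro equalityI subsetI)
    fix h assume "h \<in> {h. leaf_edge E h \<and> u \<in> h}"
    then obtain z where z: "h \<in> E" "u \<in> h" "z \<in> h" "deg E z = 1"
      by (auto simp: leaf_edge_def)
    have "z \<noteq> u" using z(4) assms(2) by blast
    moreover have "card h = 2" using z(1) assms(1) by (auto simp: fin_simple_graph_def)
    ultimately have "h = {u, z}" using z(2,3) by (auto simp: card_2_iff)
    then show "h \<in> (\<lambda>z. {u, z}) ` {z \<in> neighbours E u. deg E z = 1}"
      using z by (auto simp: neighbours_def)
  qed (auto simp: neighbours_def leaf_edge_def)
  moreover have "inj_on (\<lambda>z. {u, z}) {z \<in> neighbours E u. deg E z = 1}"
    by (auto simp: inj_on_def doubleton_eq_iff)
  ultimately show ?thesis unfolding leaf_deg_def by (simp add: card_image)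
qed

lemma ricci_flow_deriv:
  assumes "ricci_flow V E w" "fin_simple_graph V E" "acyclic_graph V E" "{u, z} \<in> E" "0 < t"
  shows "((\<lambda>s. w s {u, z}) has_real_derivative
    (real (deg E u) - 2) / inv_weight_sum E (w t) u + (real (deg E z) - 2) / inv_weight_sum E (w t) z)
      (at t)"
proof -
  interpret tree_edge V E "w t" u z
    using assms by unfold_locales (auto simp: ricci_flow_def)
  have "((\<lambda>s. w s {u, z}) has_real_derivative - lly_curvature V E (w t) u z * w t {u, z})
      (at t within {0..})"
    using assms by (auto simp: ricci_flow_def)
  moreover have "at t within {0..} = at t"
    using assms(5) by (intro at_within_interior) simp
  ultimately show ?thesis
    using lly_curvature_eq by (simp add: diff_divide_distrib algebra_simps)
qed

text \<open>With this value the term of a leaf in the flow equation,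
  \<open>(1 - 2) / inv_weight_sum E w z\<close>, becomes the decay term
  \<open>- w {u, z}\<close>.\<close>

lemma inv_weight_sum_leaf:
  assumes "fin_simple_graph V E" "{u, z} \<in> E" "deg E z = 1"
  shows "inv_weight_sum E w z = 1 / w {u, z}"
proof -
  have "u \<in> neighbours E z" using assms(2) by (simp add: neighbours_def insert_commute)
  then have "neighbours E z = {u}" using assms(3) by (auto simp: deg_def card_1_singleton_iff)
  then show ?thesis by (simp add: inv_weight_sum_def insert_commute)
qed

lemma ricci_flow_vertex:
  assumes flow: "ricci_flow V E w" and graph: "fin_simple_graph V E" and acyclic: "acyclic_graph V E"
    and v: "v \<in> neighbours E u" "deg E v = 1" and "2 < deg E u"
  shows "vertex_flow (neighbours E u) {z \<in> neighbours E u. deg E z = 1}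
    (\<lambda>z t. w t {u, z}) v (real (deg E u) - 2)"
proof
  fix z :: 'a and t :: real
  assume t: "0 < t"
  have m: "edge_metric E (w t)" using flow t by (simp add: ricci_flow_def)
  show "0 < w t {u, z}" if "z \<in> neighbours E u"
    using that m by (auto simp: edge_metric_def neighbours_def)
  show "((\<lambda>t. w t {u, z}) has_real_derivative
      (real (deg E u) - 2) / (\<Sum>y\<in>neighbours E u. 1 / w t {u, y}) - w t {u, z}) (at t)"
    if "z \<in> {z \<in> neighbours E u. deg E z = 1}"
  proof -
    have e: "{u, z} \<in> E" using that by (simp add: neighbours_def)
    then show ?thesis
      using ricci_flow_deriv[OF flow graph acyclic e t] inv_weight_sum_leaf[OF graph e, of "w t"] that
      by (simp add: inv_weight_sum_def[of _ _ u])
  qed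
  show "\<exists>D. ((\<lambda>t. w t {u, z}) has_real_derivative D) (at t) \<and>
      (real (deg E u) - 2) / (\<Sum>y\<in>neighbours E u. 1 / w t {u, y}) \<le> D"
    if z: "z \<in> neighbours E u - {z \<in> neighbours E u. deg E z = 1}"
  proof -
    have e: "{u, z} \<in> E" and u: "u \<in> neighbours E z"
      using z by (auto simp: neighbours_def insert_commute)
    have "deg E z \<noteq> 0" using u finite_neighbours[OF graph] by (auto simp: deg_def)
    then have "2 \<le> deg E z" using z by auto
    moreover have "0 < inv_weight_sum E (w t) z"
      using inv_weight_sum_pos[OF graph m] u by blast
    ultimately have "0 \<le> (real (deg E z) - 2) / inv_weight_sum E (w t) z" by simp
    then show ?thesis
      using ricci_flow_deriv[OF flow graph acyclic e t]
      by (force simp: inv_weight_sum_def[of _ _ u])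
  qed
qed (use assms finite_neighbours[OF graph] in auto)

theorem proposition5:
  fixes V :: "'a set" and E :: "'a set set" and w :: "real \<Rightarrow> 'a set \<Rightarrow> real" and u v :: 'a
  assumes "fin_tree V E"
    and "\<not> is_path_graph V E" and "\<not> is_star_graph V E"
    and "ricci_flow V E w"
    and "leaf_edge E {u, v}" and "deg E u \<ge> 3"
  shows "(leaf_deg E u = deg E u - 1 \<longleftrightarrow>
            ((\<lambda>t. lly_curvature V E (w t) u v) \<longlongrightarrow> 1 / (real (deg E u) - 1)) at_top) \<and>
         (((\<lambda>t. lly_curvature V E (w t) u v) \<longlongrightarrow> 0) at_top \<longleftrightarrow>
            leaf_deg E u = deg E u - 2)"
proof -
  have graph: "fin_simple_graph V E" and acyclic: "acyclic_graph V E"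
    using assms(1) by (auto simp: fin_tree_def)
  have edge: "{u, v} \<in> E" and v: "deg E v = 1"
    using assms(5,6) by (auto simp: leaf_edge_def)
  interpret vertex_flow "neighbours E u" "{z \<in> neighbours E u. deg E z = 1}"
    "\<lambda>z t. w t {u, z}" v "real (deg E u) - 2"
    using edge v assms(6)
    by (intro ricci_flow_vertex[OF assms(4) graph acyclic]) (auto simp: neighbours_def)
  define d d' where "d = real (deg E u)" and "d' = real (leaf_deg E u)"
  have card_L: "real (card {z \<in> neighbours E u. deg E z = 1}) = d'"
    unfolding d'_def using leaf_deg_eq[OF graph, of u] assms(6) by simp
  have d: "3 \<le> d" "0 < d'" unfolding d_def using assms(6) card_L_pos card_L by auto
  let ?\<kappa> = "\<lambda>t. lly_curvature V E (w t) u v"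
  \<comment> \<open>Multiplied by the length of the edge, the curvature is the leaf term
    \<open>w t {u, v}\<close> minus the influx \<open>G t * w t {u, v}\<close> from
    \<open>u\<close>.\<close>
  have curvature: "?\<kappa> t = 1 - G t" if t: "0 < t" for t
  proof -
    interpret tree_edge V E "w t" u v
      using assms(4) t graph acyclic edge by unfold_locales (auto simp: ricci_flow_def)
    have "?\<kappa> t * w t {u, v} = (1 - G t) * w t {u, v}"
      unfolding lly_curvature_eq using influx_eq[OF t] inv_weight_sum_leaf[OF graph edge v, of "w t"] v
      by (simp add: inv_weight_sum_def[of _ _ u] left_diff_distrib diff_divide_distrib)
    then show ?thesis using uv(4) by simp
  qed
  have \<kappa>_eq: "eventually (\<lambda>t. 1 - G t = ?\<kappa> t) at_top"
    using curvature by (intro eventually_at_top_linorderI[of 1]) simp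
  have limit: "(?\<kappa> \<longlongrightarrow> 1 - (d - 2) / d') at_top"
    if "\<And>\<epsilon>. 0 < \<epsilon> \<Longrightarrow> eventually (\<lambda>t. G t < 1 + \<epsilon>) at_top"
    using tendsto_diff[OF tendsto_const G_tendsto[OF that], of 1] \<kappa>_eq
    unfolding card_L d_def by (simp add: tendsto_cong)
  \<comment> \<open>A nonnegative limit of the curvature already forces
    \<open>limsup G \<le> 1\<close>. The limit of \<open>G\<close> is then known, and uniqueness of
    limits fixes \<open>l\<close>. Both converse directions rest on this.\<close>
  have limit_value: "l = 1 - (d - 2) / d'" if l: "(?\<kappa> \<longlongrightarrow> l) at_top" "0 \<le> l" for l
  proof (rule tendsto_unique[OF _ l(1) limit])
    fix \<epsilon> :: real assume "0 < \<epsilon>"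
    then have "eventually (\<lambda>t. - \<epsilon> < ?\<kappa> t) at_top" using l by (intro order_tendstoD(1)) auto
    then show "eventually (\<lambda>t. G t < 1 + \<epsilon>) at_top"
      using \<kappa>_eq by eventually_elim linarith
  qed simp
  have limit_ge: "(?\<kappa> \<longlongrightarrow> 1 - (d - 2) / d') at_top" if "d - 2 \<le> d'"
    using that by (intro limit G_eventually_less) (simp_all only: card_L d_def)
  have "(?\<kappa> \<longlongrightarrow> 1 / (d - 1)) at_top \<longleftrightarrow> d' = d - 1"
  proof
    assume "(?\<kappa> \<longlongrightarrow> 1 / (d - 1)) at_top"
    then have "1 / (d - 1) = 1 - (d - 2) / d'" using d by (intro limit_value) auto
    then have "(d - 2) * d' = (d - 2) * (d - 1)" using d by (simp add: field_simps)
    then show "d' = d - 1" using d by simp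
  next
    assume "d' = d - 1"
    moreover have "1 - (d - 2) / (d - 1) = 1 / (d - 1)" using d by (simp add: field_simps)
    ultimately show "(?\<kappa> \<longlongrightarrow> 1 / (d - 1)) at_top" using limit_ge by simp
  qed
  moreover have "(?\<kappa> \<longlongrightarrow> 0) at_top \<longleftrightarrow> d' = d - 2"
  proof
    assume "(?\<kappa> \<longlongrightarrow> 0) at_top"
    then have "0 = 1 - (d - 2) / d'" by (intro limit_value) auto
    then show "d' = d - 2" using d by (simp add: field_simps)
  next
    assume "d' = d - 2"
    then show "(?\<kappa> \<longlongrightarrow> 0) at_top" using limit_ge d by simp
  qed
  \<comment> \<open>Since \<open>deg E u \<ge> 3\<close>, the truncated subtractions agree with the
    real ones.\<close>
  moreover have "leaf_deg E u = deg E u - 1 \<longleftrightarrow> d' = d - 1"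
    "leaf_deg E u = deg E u - 2 \<longleftrightarrow> d' = d - 2"
    using assms(6) unfolding d_def d'_def by auto
  ultimately show ?thesis unfolding d_def by simp
qed

end
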